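(* Let $\Psi:[0,\infty)\to[-1,1]$ be a (measurable) periodic function with $\sup_{x\ge0}\int_0^x\Psi(y)\,\mathrm{d}y<\infty$ and $\limsup_{x\to\infty}\Psi(x)=1$. Let $\alpha>0$ and let $f$ be a probability density given by $$f(x)=\frac12\Big(1+\Psi\Big(\frac{1}{x^\alpha}\Big)\Big),\quad x\in(0,a],$$ and $f=0$ outside $(0,a]$, where $a\in(0,\infty)$ is such that $\int_0^af(x)\,\mathrm{d}x=1$. Then $f\le1$, $\int_0^\infty xf(x)\,\mathrm{d}x<\infty$, and there exist a non-decreasing function $g:(0,\infty)\to(0,\infty)$ and a $\lambda_0>0$ such that $$\int_\mu^{\mu+1}f(\lambda x)\,\mathrm{d}x\le1-g\big(\lambda(\mu+1)\big)\quad\text{for all }\lambda\in(0,\lambda_0),\ \mu\in[0,1].$$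
   Context: All notions are standard. *)

theory Defs
  imports "HOL-Analysis.Analysis"
begin

end

theory Submission
  imports Defs
begin

text \<open>The constant \<open>g = 1 / 4\<close> works. Up to a piece of length at most \<open>1 / 8\<close> near the
  origin, the integral of \<open>f (l x)\<close> is at most \<open>1 / 2\<close> plus half the integral of
  \<open>\<Psi> ((l x) powr - \<alpha>)\<close>. In the variable \<open>z = (l x) powr - \<alpha>\<close> the latter is an integral of
  \<open>\<Psi>\<close> against a decreasing weight of size \<open>O(l powr \<alpha>)\<close>. Since the integrals of \<open>\<Psi>\<close> over
  intervals are bounded above, the second mean value theorem makes it small with \<open>l\<close>.\<close>

lemma set_integrable_bounded_Icc:
  fixes f :: "real \<Rightarrow> real"
  assumes "f \<in> borel_measurable borel" "\<And>x. x \<in> {a..b} \<Longrightarrow> \<bar>f x\<bar> \<le> B"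
  shows "set_integrable lborel {a..b} f"
  unfolding set_integrable_def
  using assms by (intro integrableI_bounded_set_indicator[where B = B])
    (auto simp: emeasure_lborel_Icc_eq)

lemma integrable_on_bounded_Icc:
  fixes f :: "real \<Rightarrow> real"
  assumes "f \<in> borel_measurable borel" "\<And>x. x \<in> {a..b} \<Longrightarrow> \<bar>f x\<bar> \<le> B"
  shows "f integrable_on {a..b}"
  by (rule set_borel_integral_eq_integral(1)[OF set_integrable_bounded_Icc[OF assms]])

lemma absolutely_integrable_on_bounded_Icc:
  fixes f :: "real \<Rightarrow> real"
  assumes "f \<in> borel_measurable borel" "\<And>x. x \<in> {a..b} \<Longrightarrow> \<bar>f x\<bar> \<le> B"
  shows "f absolutely_integrable_on {a..b}"
  using set_integrable_bounded_Icc[OF assms] assms(1)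
  by (simp add: set_integrable_def integrable_completion)

text \<open>Shifting by a multiple of the period moves the left endpoint into the first period, where
  the primitive is at least \<open>- p\<close>; no assumption on the mean over a period is needed.\<close>

lemma periodic_integral_le:
  fixes P :: "real \<Rightarrow> real"
  assumes meas: "P \<in> borel_measurable borel"
    and bnd: "\<And>x. \<bar>P x\<bar> \<le> 1"
    and p: "p > 0" and per: "\<And>x. x \<ge> 0 \<Longrightarrow> P (x + p) = P x"
    and C: "\<And>x. x \<ge> 0 \<Longrightarrow> integral {0..x} P \<le> C"
    and cd: "0 \<le> c" "c \<le> d"
  shows "integral {c..d} P \<le> C + p"
proof -
  have int: "P integrable_on {s..t}" for s t
    using meas bnd by (rule integrable_on_bounded_Icc)
  define k where "k = nat \<lfloor>c / p\<rfloor>"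
  define r where "r = c - real k * p"
  have "real k = of_int \<lfloor>c / p\<rfloor>"
    using cd p by (simp add: k_def)
  then have "real k \<le> c / p" "c / p < real k + 1"
    by linarith+
  then have r: "0 \<le> r" "r \<le> p"
    using p by (auto simp: r_def field_simps)
  define d' where "d' = d - real k * p"
  have rd: "r \<le> d'"
    using cd by (simp add: r_def d'_def)
  \<comment> \<open>Periodicity is assumed on the half-line only; all points
    \<open>x + real n * p\<close> met in the induction lie there.\<close>
  have per_k: "P (x + real n * p) = P x" if "x \<ge> 0" for x n
  proof (induction n)
    case (Suc n)
    have "P (x + real (Suc n) * p) = P ((x + real n * p) + p)"
      by (simp add: algebra_simps)
    also have "\<dots> = P (x + real n * p)"
      using that p by (intro per) auto
    finally show ?case
      using Suc by simp
  qed auto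
  have "integral {c..d} P = integral {r..d'} (\<lambda>x. P (x + real k * p))"
    unfolding r_def d'_def by (rule integral_shift_real_ivl[symmetric])
  also have "\<dots> = integral {r..d'} P"
    using r by (intro integral_cong per_k) auto
  also have "\<dots> = integral {0..d'} P - integral {0..r} P"
    using Henstock_Kurzweil_Integration.integral_combine[OF r(1) rd int] by simp
  also have "\<dots> \<le> C + p"
  proof -
    have "integral {0..r} (\<lambda>_. -1) \<le> integral {0..r} P"
      using bnd by (intro integral_le int) (auto simp: abs_le_iff minus_le_iff)
    moreover have "integral {0..d'} P \<le> C"
      using r rd by (intro C) auto
    ultimately show ?thesis
      using r by simp
  qed
  finally show ?thesis .
qed

text \<open>The second mean value theorem splits the integral into \<open>w A\<close> times an
  integral of \<open>P\<close> up to some \<open>c\<close> and \<open>w B\<close> times the integral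
  from \<open>c\<close> on. Nonnegative weights make an upper bound on integrals of \<open>P\<close>
  enough, and \<open>w B\<close> \<le> \<open>w A\<close>.\<close>

lemma decreasing_weight_integral_le:
  fixes P w :: "real \<Rightarrow> real"
  assumes "P integrable_on {A..B}" "A \<le> B"
    and w: "\<And>x y. A \<le> x \<Longrightarrow> x \<le> y \<Longrightarrow> y \<le> B \<Longrightarrow> w y \<le> w x" "\<And>x. w x \<ge> 0"
    and K: "\<And>c d. A \<le> c \<Longrightarrow> c \<le> d \<Longrightarrow> d \<le> B \<Longrightarrow> integral {c..d} P \<le> K" and "K \<ge> 0"
  shows "integral {A..B} (\<lambda>x. w x * P x) \<le> 2 * w A * K"
proof -
  \<comment> \<open>The mean value theorem is applied to the nondecreasing function
    \<open>- w\<close>.\<close>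
  obtain c where c: "c \<in> {A..B}" and
    eq: "integral {A..B} (\<lambda>x. - w x * P x) = - w A * integral {A..c} P + - w B * integral {c..B} P"
    using second_mean_value_theorem[of P A B "\<lambda>x. - w x"] assms(1,2) w(1) by auto
  have "integral {A..B} (\<lambda>x. w x * P x) = w A * integral {A..c} P + w B * integral {c..B} P"
    using eq by simp
  also have "\<dots> \<le> w A * K + w A * K"
    using c w \<open>A \<le> B\<close> K[of A c] K[of c B] \<open>K \<ge> 0\<close>
    by (intro add_mono order_trans[OF mult_left_mono mult_right_mono] mult_left_mono) auto
  finally show ?thesis
    by (simp add: mult_ac)
qed

text \<open>The substitution \<open>z = (l y) powr - \<alpha>\<close> turns the increasingly rapid oscillations at the
  origin into the periodic ones of \<open>P\<close>, against a decreasing weight.\<close>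

lemma oscillatory_integral_le:
  fixes P :: "real \<Rightarrow> real"
  assumes meas[measurable]: "P \<in> borel_measurable borel"
    and bnd: "\<And>x. \<bar>P x\<bar> \<le> 1"
    and K: "\<And>c d. 0 \<le> c \<Longrightarrow> c \<le> d \<Longrightarrow> integral {c..d} P \<le> K"
    and pos: "\<alpha> > 0" "l > 0" "m > 0" and "m \<le> v"
  shows "integral {m..v} (\<lambda>y. P (1 / (l * y) powr \<alpha>))
           \<le> 2 * ((l * v) powr (1 + \<alpha>) / (\<alpha> * l)) * K"
proof -
  \<comment> \<open>The substitution reverses order: \<open>A\<close> comes from \<open>v\<close>
    and \<open>B\<close> from \<open>m\<close>. Its inverse is \<open>g\<close>, with derivative
    \<open>g'\<close>; the decreasing weight is the absolute value of \<open>g'\<close>.\<close>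
  define A B where "A = (l * v) powr - \<alpha>" and "B = (l * m) powr - \<alpha>"
  define g where "g z = z powr (- 1 / \<alpha>) / l" for z
  define g' where "g' z = - (z powr (- 1 / \<alpha> - 1) / (\<alpha> * l))" for z
  have A: "0 < A" "A \<le> B"
    using pos \<open>m \<le> v\<close> by (auto simp: A_def B_def intro!: powr_mono2')
  have g: "g ((l * y) powr - \<alpha>) = y" if "y > 0" for y
    using that pos by (simp add: g_def powr_powr)
  have g_inv: "1 / (l * g z) powr \<alpha> = z" if "z > 0" for z
    using that pos by (simp add: g_def powr_powr flip: powr_minus_divide)
  have gAB: "g A = v" "g B = m"
    using g[of v] g[of m] pos \<open>m \<le> v\<close> by (auto simp: A_def B_def)
  have img: "g ` {A..B} = {m..v}"
  proof
    have "g y \<le> g x" if "A \<le> x" "x \<le> y" for x y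
      using that A pos by (auto simp: g_def intro!: divide_right_mono powr_mono2')
    then show "g ` {A..B} \<subseteq> {m..v}"
      unfolding gAB[symmetric] by auto
    show "{m..v} \<subseteq> g ` {A..B}"
    proof
      fix y assume y: "y \<in> {m..v}"
      then have "(l * y) powr - \<alpha> \<in> {A..B}"
        using pos by (auto simp: A_def B_def intro!: powr_mono2')
      moreover have "y = g ((l * y) powr - \<alpha>)"
        using y pos g by simp
      ultimately show "y \<in> g ` {A..B}"
        by blast
    qed
  qed
  have inj: "inj_on g {A..B}"
    using A g_inv by (intro inj_on_inverseI[where g = "\<lambda>y. 1 / (l * y) powr \<alpha>"]) auto
  have der: "(g has_field_derivative g' z) (at z within {A..B})" if "z \<in> {A..B}" for z
    unfolding g_def g'_def using that A pos
    by (auto intro!: derivative_eq_intros simp: field_simps)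
  have K0: "K \<ge> 0"
    using K[of 0 0] by simp
  have "(\<lambda>y. P (1 / (l * y) powr \<alpha>)) absolutely_integrable_on g ` {A..B}"
    unfolding img using bnd by (intro absolutely_integrable_on_bounded_Icc[where B = 1]) auto
  \<comment> \<open>The change of variables is an equivalence for a prescribed value; prescribing
    the integral over \<open>{m..v}\<close> yields the equality.\<close>
  then have "integral {m..v} (\<lambda>y. P (1 / (l * y) powr \<alpha>))
      = integral {A..B} (\<lambda>z. \<bar>g' z\<bar> * P (1 / (l * g z) powr \<alpha>))"
    using has_absolute_integral_change_of_variables_1'[OF _ der inj,
        of "\<lambda>y. P (1 / (l * y) powr \<alpha>)" "integral {m..v} (\<lambda>y. P (1 / (l * y) powr \<alpha>))"]
    unfolding img by simp
  also have "\<dots> = integral {A..B} (\<lambda>z. \<bar>g' z\<bar> * P z)"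
    using A g_inv by (intro integral_cong) auto
  also have "\<dots> \<le> 2 * \<bar>g' A\<bar> * K"
  proof (rule decreasing_weight_integral_le)
    show "P integrable_on {A..B}"
      using meas bnd by (rule integrable_on_bounded_Icc)
    show "\<bar>g' y\<bar> \<le> \<bar>g' x\<bar>" if "A \<le> x" "x \<le> y" for x y
    proof -
      have "- 1 / \<alpha> - 1 \<le> 0"
        using pos divide_nonpos_pos[of "- 1" \<alpha>] by linarith
      then have "y powr (- 1 / \<alpha> - 1) \<le> x powr (- 1 / \<alpha> - 1)"
        using that A by (intro powr_mono2') auto
      then show ?thesis
        using pos by (simp add: g'_def abs_mult divide_right_mono)
    qed
  qed (use A K K0 in auto)
  also have "\<bar>g' A\<bar> = (l * v) powr (1 + \<alpha>) / (\<alpha> * l)"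
  proof -
    have "- \<alpha> * (- 1 / \<alpha> - 1) = 1 + \<alpha>"
      using pos by (simp add: field_simps)
    then have "A powr (- 1 / \<alpha> - 1) = (l * v) powr (1 + \<alpha>)"
      by (simp only: A_def powr_powr)
    then show ?thesis
      using pos by (simp add: g'_def abs_mult)
  qed
  finally show ?thesis .
qed

theorem proposition3p4:
  fixes \<Psi> f :: "real \<Rightarrow> real" and \<alpha> a :: real
  assumes Psi_range: "\<Psi> \<in> {0..} \<rightarrow> {-1..1}"
    and Psi_measurable: "\<Psi> \<in> borel_measurable (restrict_space borel {0..})"
    and Psi_periodic: "\<exists>p>0. \<forall>x\<ge>0. \<Psi> (x + p) = \<Psi> x"
    and Psi_integral: "bdd_above ((\<lambda>x. LBINT y:{0..x}. \<Psi> y) ` {0..})"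
    and Psi_limsup: "Limsup at_top (\<lambda>x. ereal (\<Psi> x)) = 1"
    and alpha: "\<alpha> > 0"
    and a: "a > 0"
    and f_eq: "\<And>x. f x = (if x \<in> {0<..a} then 1 / 2 * (1 + \<Psi> (1 / (x powr \<alpha>))) else 0)"
    and f_density: "(LBINT x:{0<..a}. f x) = 1"
  shows "(\<forall>x. f x \<le> 1)
    \<and> (\<integral>\<^sup>+x\<in>{0..}. ennreal (x * f x) \<partial>lborel) < \<infinity>
    \<and> (\<exists>g l\<^sub>0. g \<in> {0<..} \<rightarrow> {0<..} \<and> mono_on {0<..} g \<and> l\<^sub>0 > 0
          \<and> (\<forall>l\<in>{0<..<l\<^sub>0}. \<forall>\<mu>\<in>{0..1}.
                (LBINT x:{\<mu>..\<mu> + 1}. f (l * x)) \<le> 1 - g (l * (\<mu> + 1))))"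
proof -
  \<comment> \<open>Extending \<Psi> by 0 to the negative axis gives a function that is Borel and
    bounded by 1 on the whole line. Integrals over \<open>{0..x}\<close> and the values entering
    \<open>f\<close> are unchanged.\<close>
  define P where "P x = indicator {0..} x *\<^sub>R \<Psi> x" for x
  have P_eq: "P x = \<Psi> x" if "x \<ge> 0" for x
    using that by (simp add: P_def)
  have meas[measurable]: "P \<in> borel_measurable borel"
    using Psi_measurable unfolding P_def by (subst (asm) borel_measurable_restrict_space_iff) auto
  have bnd: "\<bar>P x\<bar> \<le> 1" for x
    using Psi_range by (auto simp: P_def indicator_def abs_le_iff Pi_iff minus_le_iff)
  have P_int: "set_integrable lborel {s..t} P" for s t
    using meas bnd by (rule set_integrable_bounded_Icc)
  obtain p where p: "p > 0" "\<And>x. x \<ge> 0 \<Longrightarrow> P (x + p) = P x"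
    using Psi_periodic by (auto simp: P_eq)
  obtain C where C: "\<And>x. x \<ge> 0 \<Longrightarrow> (LBINT y:{0..x}. \<Psi> y) \<le> C"
    using Psi_integral by (auto simp: bdd_above_def)
  have C': "integral {0..x} P \<le> C" if "x \<ge> 0" for x
  proof -
    have "integral {0..x} P = (LBINT y:{0..x}. P y)"
      by (rule set_borel_integral_eq_integral(2)[OF P_int, symmetric])
    also have "\<dots> = (LBINT y:{0..x}. \<Psi> y)"
      by (intro set_lebesgue_integral_cong) (auto simp: P_eq)
    finally show ?thesis
      using C[OF that] by simp
  qed
  define K where "K = C + p"
  have K: "integral {c..d} P \<le> K" if "0 \<le> c" "c \<le> d" for c d
    unfolding K_def using meas bnd p C' that by (rule periodic_integral_le)
  \<comment> \<open>At \<open>x = 0\<close> the integral vanishes, so \<open>C\<close> is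
    nonnegative and \<open>K\<close> is at least \<open>p\<close>. Strict positivity allows division
    by \<open>K\<close> in \<open>D\<close>.\<close>
  have K0: "K > 0"
    using C'[of 0] p by (simp add: K_def)

  have f_P: "f x = (if x \<in> {0<..a} then 1 / 2 * (1 + P (1 / (x powr \<alpha>))) else 0)" for x
    by (simp add: f_eq P_eq)
  have f_meas[measurable]: "f \<in> borel_measurable borel"
    unfolding f_P[abs_def] by measurable
  have f_bnd: "0 \<le> f x" "f x \<le> 1" for x
    using bnd[of "1 / (x powr \<alpha>)"] by (auto simp: f_P abs_le_iff)

  have "(\<integral>\<^sup>+x\<in>{0..}. ennreal (x * f x) \<partial>lborel) \<le> (\<integral>\<^sup>+x. ennreal a * indicator {0..a} x \<partial>lborel)"
  proof (rule nn_integral_mono)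
    fix x
    have "x * f x \<le> a * 1" if "x \<in> {0..a}"
      using that f_bnd[of x] a by (intro mult_mono) auto
    moreover have "f x = 0" if "x > a"
      using that by (simp add: f_P)
    ultimately show "ennreal (x * f x) * indicator {0..} x \<le> ennreal a * indicator {0..a} x"
      by (auto simp: indicator_def intro!: ennreal_leI)
  qed
  also have "\<dots> < \<infinity>"
    using a by (simp add: nn_integral_cmult ennreal_mult_less_top)
  finally have moment: "(\<integral>\<^sup>+x\<in>{0..}. ennreal (x * f x) \<partial>lborel) < \<infinity>" .

  \<comment> \<open>\<open>D\<close> solves
    \<open>2 * (2 powr (1 + \<alpha>) / \<alpha> * D) * K = 1 / 4\<close>, the bound wanted for the
    oscillatory integral. Below \<open>l\<^sub>0\<close>, \<open>l powr \<alpha>\<close> is at most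
    \<open>D\<close>, and \<open>l * x\<close> stays within \<open>a\<close> for all
    \<open>x\<close> up to 2.\<close>
  define D where "D = \<alpha> / (8 * K * 2 powr (1 + \<alpha>))"
  define l\<^sub>0 where "l\<^sub>0 = min (a / 2) (D powr (1 / \<alpha>))"
  have D: "D > 0"
    using alpha K0 by (simp add: D_def)
  have l0: "l\<^sub>0 > 0"
    using D a by (simp add: l\<^sub>0_def)
  have bound: "(LBINT x:{\<mu>..\<mu> + 1}. f (l * x)) \<le> 1 - 1 / 4"
    if l: "l \<in> {0<..<l\<^sub>0}" and mu: "\<mu> \<in> {0..1}" for l \<mu>
  proof -
    \<comment> \<open>Cutting at \<open>1 / 8\<close> keeps the left endpoint positive, so that the
      substitution has a bounded range, and removes a piece of length at most
      \<open>1 / 8\<close>.\<close>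
    define m v where "m = max \<mu> (1 / 8)" and "v = \<mu> + 1"
    have m: "m > 0" "m \<le> v" "\<mu> \<le> m" "m \<le> \<mu> + 1 / 8" and v: "v \<le> 2" "0 < v"
      using mu by (auto simp: m_def v_def)
    have fl_int: "(\<lambda>x. f (l * x)) integrable_on {s..t}" for s t
      using f_bnd by (intro integrable_on_bounded_Icc[where B = 1]) auto
    have Pl_int: "(\<lambda>x. P (1 / (l * x) powr \<alpha>)) integrable_on {s..t}" for s t
      using bnd by (intro integrable_on_bounded_Icc[where B = 1]) auto
    have "(l * v) powr (1 + \<alpha>) / (\<alpha> * l) \<le> (l * 2) powr (1 + \<alpha>) / (\<alpha> * l)"
      using l v alpha by (intro divide_right_mono powr_mono2) auto
    \<comment> \<open>One factor \<open>l\<close> of \<open>l powr (1 + \<alpha>)\<close> cancels,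
      leaving a power that tends to 0 with \<open>l\<close>, uniformly in \<mu>.\<close>
    also have "\<dots> = 2 powr (1 + \<alpha>) / \<alpha> * l powr \<alpha>"
      using l alpha by (simp add: powr_mult powr_add)
    also have "\<dots> \<le> 2 powr (1 + \<alpha>) / \<alpha> * D"
    proof -
      have "l powr \<alpha> \<le> (D powr (1 / \<alpha>)) powr \<alpha>"
        using l alpha by (intro powr_mono2) (auto simp: l\<^sub>0_def)
      then have "l powr \<alpha> \<le> D"
        using alpha D by (simp add: powr_powr)
      then show ?thesis
        using alpha by (intro mult_left_mono) auto
    qed
    also have "\<dots> = 1 / (8 * K)"
      using alpha K0 by (simp add: D_def)
    finally have "2 * ((l * v) powr (1 + \<alpha>) / (\<alpha> * l)) * K \<le> 2 * (1 / (8 * K)) * K"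
      using K0 by (intro mult_right_mono mult_left_mono) auto
    then have osc: "integral {m..v} (\<lambda>x. P (1 / (l * x) powr \<alpha>)) \<le> 1 / 4"
      using oscillatory_integral_le[OF meas bnd K alpha, of l m v] l m K0 by simp

    have "(LBINT x:{\<mu>..\<mu> + 1}. f (l * x)) = integral {\<mu>..v} (\<lambda>x. f (l * x))"
      unfolding v_def using f_bnd
      by (intro set_borel_integral_eq_integral(2) set_integrable_bounded_Icc[where B = 1]) auto
    also have "\<dots> = integral {\<mu>..m} (\<lambda>x. f (l * x)) + integral {m..v} (\<lambda>x. f (l * x))"
      using m by (intro Henstock_Kurzweil_Integration.integral_combine[symmetric] fl_int)
    finally have split: "(LBINT x:{\<mu>..\<mu> + 1}. f (l * x))
        = integral {\<mu>..m} (\<lambda>x. f (l * x)) + integral {m..v} (\<lambda>x. f (l * x))" .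

    have "integral {\<mu>..m} (\<lambda>x. f (l * x)) \<le> integral {\<mu>..m} (\<lambda>_. 1)"
      using f_bnd by (intro integral_le fl_int) auto
    also have "\<dots> = m - \<mu>"
      using m by simp
    finally have head: "integral {\<mu>..m} (\<lambda>x. f (l * x)) \<le> m - \<mu>" .

    have "integral {m..v} (\<lambda>x. f (l * x))
        = integral {m..v} (\<lambda>x. 1 / 2 + 1 / 2 * P (1 / (l * x) powr \<alpha>))"
    proof (rule integral_cong)
      fix x assume x: "x \<in> {m..v}"
      have "l * x \<le> (a / 2) * 2"
        using x m l v a by (intro mult_mono) (auto simp: l\<^sub>0_def)
      moreover have "0 < l * x"
        using x m l by simp
      ultimately show "f (l * x) = 1 / 2 + 1 / 2 * P (1 / (l * x) powr \<alpha>)"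
        by (simp add: f_P)
    qed
    also have "\<dots> = 1 / 2 * (v - m) + 1 / 2 * integral {m..v} (\<lambda>x. P (1 / (l * x) powr \<alpha>))"
      using m by (subst integral_add) (auto intro: integrable_on_cmult_left Pl_int)
    also have "\<dots> \<le> 1 / 2 * (v - m) + 1 / 8"
      using osc by simp
    finally have tail: "integral {m..v} (\<lambda>x. f (l * x)) \<le> 1 / 2 * (v - m) + 1 / 8" .
    \<comment> \<open>As \<open>v - \<mu> = 1\<close>, the left side is
      \<open>(m - \<mu>) / 2 + 5 / 8\<close>, hence at most \<open>11 / 16\<close>.\<close>
    have "(m - \<mu>) + (1 / 2 * (v - m) + 1 / 8) \<le> 1 - 1 / 4"
      using m by (simp add: v_def field_simps)
    then show ?thesis
      using add_mono[OF head tail] unfolding split by (rule order_trans[rotated])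
  qed

  show ?thesis
  proof (intro conjI allI exI[of _ "\<lambda>_. 1 / 4 :: real"] exI[of _ "l\<^sub>0"] ballI)
    show "mono_on {0<..} (\<lambda>_::real. 1 / 4 :: real)"
      by (simp add: mono_on_def)
  qed (use f_bnd moment l0 bound in auto)
qed

end
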